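(* Let $q$ be a prime power, $m\ge1$, $1\le k\le q-1$. Let $k+1\le s\le q$ and $t=\lfloor\frac{s-k-1}{2}\rfloor$. For every $\delta\le\frac{t+1}{2s}$, the code $\mathrm{PLift}_q(m,k)$ is a perfectly smooth $\big(s,\delta,\frac{\delta s}{t+1}\big)$-locally correctable code, using the algorithm $\mathsf{Corr}^{\mathrm{PLift}}_s$ described in the context.
   Context: **Codes.** $\mathbb P^m=(\mathbb F_q^{m+1}\setminus\{0\})/\mathbb F_q^\times$; the standard representative of a point is the one whose leftmost non-zero coordinate is $1$, and points are always written in this representation when polynomials or linear maps are evaluated at them. $n=|\mathbb P^m|=\frac{q^{m+1}-1}{q-1}$. $\mathbb F_q[\mathbf X]^H_v$ is the space of homogeneous polynomials of degree $v$ in $X_0,\dots,X_m$ (together with $0$), and $\mathrm{ev}_{\mathbb P^m}(f)=(f(\mathbf P))_{\mathbf P\in\mathbb P^m}$, evaluating at standard representatives. $\mathrm{PRS}_q(k)=\{\mathrm{ev}_{\mathbb P^1}(g): g\in\mathbb F_q[S,T]^H_k\}$. $\mathrm{Emb}_{\mathbb P}(m)$ is the set of injective $\mathbb F_q$-linear maps $L:\mathbb F_q^2\to\mathbb F_q^{m+1}$, and $f\circ L=f(L(S,T))$. For $v=k+(m-1)(q-1)$, $$\mathrm{PLift}_q(m,k)=\{\mathrm{ev}_{\mathbb P^m}(f): f\in\mathbb F_q[\mathbf X]^H_v,\ \forall L\in\mathrm{Emb}_{\mathbb P}(m),\ \mathrm{ev}_{\mathbb P^1}(f\circ L)\in\mathrm{PRS}_q(k)\}\subseteq\mathbb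 F_q^{\mathbb P^m}.$$ **Local correctability.** Let $\Sigma$ be a finite set, $2\le\ell\le K\le N$ integers, and $\delta,\epsilon\in[0,1]$. A code $\mathcal C:\Sigma^K\to\mathbb F_q^N$ is $(\ell,\delta,\epsilon)$-locally correctable if and only if there is a randomized algorithm $\mathcal D$ such that, for every input $i\in[1,N]$: (a) for all $c\in\mathcal C$ and all $y\in\mathbb F_q^N$ with $|\{j: y_j\ne c_j\}|\le\delta N$, one has $\Pr(\mathcal D^{(y)}(i)=c_i)\ge1-\epsilon$, the probability being over the internal randomness of $\mathcal D$; (b) $\mathcal D$ reads at most $\ell$ symbols of $y$. Here $\mathcal D^{(y)}$ means that $\mathcal D$ has oracle access to single symbols of $y$. The code is perfectly smooth if, on arbitrary input $i$, each individual query of $\mathcal D$ is uniformly distributed over the coordinates of $y$. **Ingredients of the algorithm.** Write $\infty=(0:1)\in\mathbb P^1$. For $\mathbf P\in\mathbb P^m$, $\mathrm{Emb}_{\mathbb P}(m,\mathbf P)$ is the set of $L\in\mathrm{Emb}_{\mathbb P}(m)$ with $L(\infty)=\mathbf P$ (i.e. $L(0,1)$ is the standard representative of $\mathbf P$). For $L\in\mathrm{Emb}_{\mathbb P}(m)$ and $\mathbf Q\in\mathbb P^1$, let $\lambda_{L,\mathbf Q}\in\mathbb F_q^\times$ be such that $\lambda_{L,\mathbf Q}L(\mathbf Q)$ is the standard representative of the point $L(\mathbf Q)\in\mathbb P^m$, and let $w^v_{L,\mathbf Q}=(\lambda_{L,\mathbf Q})^v$; thus for $f\in\mathbb F_q[\mathbf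 X]^H_v$ the symbol of $\mathrm{ev}_{\mathbb P^m}(f)$ at $L(\mathbf Q)$ equals $w^v_{L,\mathbf Q}\,(f\circ L)(\mathbf Q)$. One assumes given a randomized query generator $\mathcal R_s$ taking as parameters $\mathbf P\in\mathbb P^m$ and $L\in\mathrm{Emb}_{\mathbb P}(m,\mathbf P)$ and such that, for all $\mathbf P$: for every $L\in\mathrm{Emb}_{\mathbb P}(m,\mathbf P)$, its output $S$ is a subset of $L(\mathbb P^1)$ with $|S|=s$; and for every $\mathbf R\in\mathbb P^m$, $\Pr[\mathbf R\in S]=s/n$ when $L$ is uniform in $\mathrm{Emb}_{\mathbb P}(m,\mathbf P)$ and $S\leftarrow\mathcal R_s(\mathbf P,L)$. (Such a generator can be implemented.) One also assumes given an error-and-erasure correcting algorithm $\mathsf{Corr}^{\mathrm{PRS}}_s$ for $\mathrm{PRS}_q(k)$ which corrects $q+1-s$ erasures and up to $t$ errors. **The algorithm $\mathsf{Corr}^{\mathrm{PLift}}_s$.** Input: a word $y\in\mathbb F_q^{\mathbb P^m}$ at Hamming distance at most $\delta n$ from some codeword $c\in\mathrm{PLift}_q(m,k)$, and a point $\mathbf P\in\mathbb P^m$. Output: the symbol $c_{\mathbf P}$. 1. Pick $L$ uniformly at random in $\mathrm{Emb}_{\mathbb P}(m,\mathbf P)$, and pick $S=\{\mathbf R_1,\dots,\mathbf R_s\}\leftarrow\mathcal R_s(\mathbf P,L)$; let $\mathbf Q_j\in\mathbb P^1$ be such that $\mathbf R_j=L(\mathbf Q_j)$. 2. Read $y_{\mathbf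 R_1},\dots,y_{\mathbf R_s}$ and define $y'$ indexed by $\mathbb P^1$ by $y'_{\mathbf Q_j}=(w^v_{L,\mathbf Q_j})^{-1}y_{\mathbf R_j}$ for $j=1,\dots,s$, and $y'_{\mathbf Q}=\perp$ (erasure) for all other $\mathbf Q$. 3. Use $\mathsf{Corr}^{\mathrm{PRS}}_s$ to correct $y'$ as a noisy codeword of $\mathrm{PRS}_q(k)$. 4. If this succeeds, return the corrected symbol $y'(\infty)$; otherwise return $\perp$. *)

theory Defs
  imports
    "HOL-Analysis.Analysis"
    "HOL-Probability.Probability"
    "HOL-Library.Poly_Mapping"
    "HOL-Combinatorics.Multiset_Permutations"
begin

section \<open>Projective space and standard representatives\<close>

text \<open>
  The field with \<open>q\<close> elements is a type \<open>'a :: {field, finite}\<close> with \<open>q = CARD('a)\<close>, and its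
  \<open>(m+1)\<close>-st power is \<open>'a ^ 'n\<close> for a finite linearly ordered index type with
  \<open>CARD('n) = m + 1\<close>; the order of \<open>'n\<close> is the left-to-right order of the coordinates.
  In the plane \<open>'a ^ 2\<close> the index type \<open>2\<close> consists of \<open>0 < 1\<close>, so the left coordinate
  is \<open>x $ 0\<close> and the right one is \<open>x $ 1\<close> (note that \<open>2 = 0\<close> in this type, hence the order
  of the indices is not the one suggested by the names \<open>1\<close>, \<open>2\<close>).
\<close>

definition proj_rel :: "'a::field ^ 'n::finite \<Rightarrow> 'a ^ 'n \<Rightarrow> bool" where
  "proj_rel x y \<longleftrightarrow> x \<noteq> 0 \<and> (\<exists>c. c \<noteq> 0 \<and> y = c *s x)"

lemma part_equivp_proj_rel: "part_equivp (proj_rel :: 'a::field ^ 'n::finite \<Rightarrow> _)"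
proof (rule part_equivpI)
  have "proj_rel (\<chi> i. (1::'a)) (\<chi> i. (1::'a))"
    unfolding proj_rel_def
    by (auto simp: vec_eq_iff intro!: exI[of _ 1])
  then show "\<exists>x. proj_rel x (x :: 'a ^ 'n)" by blast
  show "symp (proj_rel :: 'a ^ 'n \<Rightarrow> _)"
  proof (rule sympI)
    fix x y :: "'a ^ 'n"
    assume "proj_rel x y"
    then obtain c where c: "x \<noteq> 0" "c \<noteq> 0" "y = c *s x" by (auto simp: proj_rel_def)
    then have "x = inverse c *s y" by (simp add: vector_smult_assoc)
    moreover have "y \<noteq> 0" using c by (simp add: vec.scale_eq_0_iff)
    ultimately show "proj_rel y x" using c unfolding proj_rel_def
      by (intro conjI exI[of _ "inverse c"]) auto
  qed
  show "transp (proj_rel :: 'a ^ 'n \<Rightarrow> _)"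
  proof (rule transpI)
    fix x y z :: "'a ^ 'n"
    assume "proj_rel x y" "proj_rel y z"
    then obtain c d where "x \<noteq> 0" "c \<noteq> 0" "y = c *s x" "d \<noteq> 0" "z = d *s y"
      by (auto simp: proj_rel_def)
    then show "proj_rel x z" unfolding proj_rel_def
      by (intro conjI exI[of _ "d * c"]) (auto simp: vector_smult_assoc)
  qed
qed

quotient_type (overloaded) ('a, 'n) proj = "'a::field ^ 'n::finite" / partial: proj_rel
  by (rule part_equivp_proj_rel)

instance proj :: ("{field, finite}", finite) finite
proof
  have "surj (abs_proj :: ('a, 'b) vec \<Rightarrow> ('a::{field, finite}, 'b::finite) proj)"
    by (metis Quotient_proj Quotient_abs_rep surjI)
  then show "finite (UNIV :: ('a::{field, finite}, 'b::finite) proj set)"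
    using finite_imageI[OF finite[of "UNIV :: ('a, 'b) vec set"]] by metis
qed

definition leftmost_one :: "'a::field ^ 'n::{finite, linorder} \<Rightarrow> bool" where
  "leftmost_one x \<longleftrightarrow> (\<exists>i. x $ i = 1 \<and> (\<forall>j<i. x $ j = 0))"

definition std_rep :: "('a::field, 'n::{finite, linorder}) proj \<Rightarrow> ('a, 'n) vec" where
  "std_rep P = (THE x. x \<noteq> 0 \<and> abs_proj x = P \<and> leftmost_one x)"

lemma std_rep_ex1:
  "\<exists>!x. x \<noteq> 0 \<and> abs_proj x = P \<and> leftmost_one (x :: 'a::field ^ 'n::{finite, linorder})"
proof -
  have abs_eq: "abs_proj x = abs_proj y \<longleftrightarrow> proj_rel x y"
    if "x \<noteq> 0" "y \<noteq> 0" for x y :: "('a, 'n) vec"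
  proof -
    have "proj_rel z z" if "z \<noteq> 0" for z :: "('a, 'n) vec"
      unfolding proj_rel_def using that by (intro conjI exI[of _ 1]) auto
    then show ?thesis using that Quotient_rel[OF Quotient_proj] by blast
  qed
  obtain z :: "('a, 'n) vec" where z: "z \<noteq> 0" "abs_proj z = P"
    by (metis Quotient_proj Quotient_abs_rep Quotient_rep_reflp proj_rel_def)
  define i where "i = Min {i. z $ i \<noteq> 0}"
  have ne: "{i. z $ i \<noteq> 0} \<noteq> {}" using z(1) by (auto simp: vec_eq_iff)
  have i: "z $ i \<noteq> 0" using Min_in[OF _ ne] by (simp add: i_def)
  have lt: "z $ j = 0" if "j < i" for j
    using that Min_le[of "{i. z $ i \<noteq> 0}" j] unfolding i_def
    by (metis (mono_tags, lifting) finite leD mem_Collect_eq)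
  define x where "x = inverse (z $ i) *s z"
  have x: "x \<noteq> 0" "leftmost_one x"
    using i lt z by (auto simp: x_def leftmost_one_def vec.scale_eq_0_iff intro!: exI[of _ i])
  have "proj_rel z x" unfolding proj_rel_def x_def using i z
    by (intro conjI exI[of _ "inverse (z $ i)"]) auto
  then have xP: "abs_proj x = P" using abs_eq z x by metis
  show ?thesis
  proof (rule ex1I[of _ x])
    show "x \<noteq> 0 \<and> abs_proj x = P \<and> leftmost_one x" using x xP by blast
    fix y assume y: "y \<noteq> 0 \<and> abs_proj y = P \<and> leftmost_one y"
    then have "proj_rel x y" using abs_eq x xP by metis
    then obtain c where c: "c \<noteq> 0" "y = c *s x" by (auto simp: proj_rel_def)
    obtain a where a: "x $ a = 1" "\<And>j. j < a \<Longrightarrow> x $ j = 0"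
      using x by (auto simp: leftmost_one_def)
    obtain b where b: "y $ b = 1" "\<And>j. j < b \<Longrightarrow> y $ j = 0"
      using y by (auto simp: leftmost_one_def)
    have "a = b"
      using a b c by (metis linorder_neqE mult_eq_0_iff one_neq_zero vector_smult_component)
    then have "c = 1" using a b c by simp
    then show "y = x" using c by simp
  qed
qed

section \<open>Homogeneous polynomials and codes\<close>

type_synonym ('n, 'a) mpoly = "('n \<Rightarrow>\<^sub>0 nat) \<Rightarrow>\<^sub>0 'a"

definition homogeneous :: "nat \<Rightarrow> ('n::finite, 'a::field) mpoly \<Rightarrow> bool" where
  "homogeneous d f \<longleftrightarrow> (\<forall>e \<in> Poly_Mapping.keys f. (\<Sum>i\<in>UNIV. Poly_Mapping.lookup e i) = d)"

definition mpoly_eval :: "('n::finite, 'a::field) mpoly \<Rightarrow> ('a, 'n) vec \<Rightarrow> 'a" where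
  "mpoly_eval f x =
     (\<Sum>e\<in>Poly_Mapping.keys f. Poly_Mapping.lookup f e * (\<Prod>i\<in>UNIV. (x $ i) ^ Poly_Mapping.lookup e i))"

definition ev :: "('n::{finite, linorder}, 'a::field) mpoly \<Rightarrow> ('a, 'n) proj \<Rightarrow> 'a" where
  "ev f P = mpoly_eval f (std_rep P)"

definition PRS :: "nat \<Rightarrow> (('a::{field, finite}, 2) proj \<Rightarrow> 'a) set" where
  "PRS k = {ev g | g. homogeneous k g}"

definition Emb :: "('a::field ^ 2 \<Rightarrow> 'a ^ 'n::finite) set" where
  "Emb = {L. Vector_Spaces.linear (*s) (*s) L \<and> inj L}"

text \<open>The \<open>i\<close>-th coordinate of \<open>L(S, T)\<close>, as a linear form in \<open>S\<close> and \<open>T\<close>.\<close>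

definition coord_form :: "('a::field ^ 2 \<Rightarrow> 'a ^ 'n::finite) \<Rightarrow> 'n \<Rightarrow> (2, 'a) mpoly" where
  "coord_form L i =
     (\<Sum>j\<in>UNIV. Poly_Mapping.single (Poly_Mapping.single j 1) (L (axis j 1) $ i))"

definition mpoly_comp ::
    "('n::finite, 'a::field) mpoly \<Rightarrow> ('a ^ 2 \<Rightarrow> ('a, 'n) vec) \<Rightarrow> (2, 'a) mpoly" where
  "mpoly_comp f L =
     (\<Sum>e\<in>Poly_Mapping.keys f.
        Poly_Mapping.single 0 (Poly_Mapping.lookup f e) * (\<Prod>i\<in>UNIV. coord_form L i ^ Poly_Mapping.lookup e i))"

text \<open>\<open>v = k + (m - 1)(q - 1)\<close>, where \<open>m = CARD('n) - 1 \<ge> 1\<close>.\<close>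

definition lift_degree :: "'a itself \<Rightarrow> 'n itself \<Rightarrow> nat \<Rightarrow> nat" where
  "lift_degree _ _ k = k + (CARD('n) - 1 - 1) * (CARD('a) - 1)"

definition PLift :: "nat \<Rightarrow> (('a::{field, finite}, 'n::{finite, linorder}) proj \<Rightarrow> 'a) set" where
  "PLift k = {ev f | f. homogeneous (lift_degree TYPE('a) TYPE('n) k) f \<and>
                        (\<forall>L\<in>Emb. ev (mpoly_comp f L) \<in> PRS k)}"

section \<open>Randomized oracle algorithms and local correctability\<close>

text \<open>
  A deterministic algorithm with oracle access to a word \<open>y :: 'i \<Rightarrow> 's\<close> is an adaptive query
  tree; a randomized one is a probability distribution on such trees (the internal random
  choices).  A result \<open>None\<close> of a corrector is the failure symbol.
\<close>

datatype ('i, 's, 'r) query_tree =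
    Answer 'r
  | Ask 'i "'s \<Rightarrow> ('i, 's, 'r) query_tree"

primrec run :: "('i \<Rightarrow> 's) \<Rightarrow> ('i, 's, 'r) query_tree \<Rightarrow> 'r" where
  "run y (Answer r) = r"
| "run y (Ask i k) = run y (k (y i))"

primrec queries :: "('i \<Rightarrow> 's) \<Rightarrow> ('i, 's, 'r) query_tree \<Rightarrow> 'i list" where
  "queries y (Answer r) = []"
| "queries y (Ask i k) = i # queries y (k (y i))"

primrec ask_all ::
    "'i list \<Rightarrow> ('s list \<Rightarrow> ('i, 's, 'r) query_tree) \<Rightarrow> ('i, 's, 'r) query_tree" where
  "ask_all [] k = k []"
| "ask_all (i # is) k = Ask i (\<lambda>a. ask_all is (\<lambda>as. k (a # as)))"

type_synonym ('i, 's) corrector = "'i \<Rightarrow> ('i, 's, 's option) query_tree pmf"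

definition hamming_dist :: "('i::finite \<Rightarrow> 's) \<Rightarrow> ('i \<Rightarrow> 's) \<Rightarrow> nat" where
  "hamming_dist y c = card {j. y j \<noteq> c j}"

text \<open>
  A code with parameters \<open>\<Sigma>\<close>, \<open>K\<close> is the image of a map from the words of length \<open>K\<close> over a
  finite set \<open>\<Sigma>\<close>; this map is not required to be injective.
\<close>

definition is_code :: "('i::finite \<Rightarrow> 's) set \<Rightarrow> nat set \<Rightarrow> nat \<Rightarrow> bool" where
  "is_code C \<Sigma> K \<longleftrightarrow>
     finite \<Sigma> \<and> (\<exists>enc :: nat list \<Rightarrow> 'i \<Rightarrow> 's. enc ` {w. length w = K \<and> set w \<subseteq> \<Sigma>} = C)"

definition locally_correctable_by ::
    "('i::finite \<Rightarrow> 's) set \<Rightarrow> nat \<Rightarrow> real \<Rightarrow> real \<Rightarrow> ('i, 's) corrector \<Rightarrow> bool" where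
  "locally_correctable_by C l \<delta> \<epsilon> D \<longleftrightarrow>
     (\<exists>\<Sigma> K. is_code C \<Sigma> K \<and> 2 \<le> l \<and> l \<le> K \<and> K \<le> CARD('i)) \<and>
     0 \<le> \<delta> \<and> \<delta> \<le> 1 \<and> 0 \<le> \<epsilon> \<and> \<epsilon> \<le> 1 \<and>
     (\<forall>i. (\<forall>c\<in>C. \<forall>y. real (hamming_dist y c) \<le> \<delta> * real CARD('i) \<longrightarrow>
             measure_pmf.prob (D i) {T. run y T = Some (c i)} \<ge> 1 - \<epsilon>) \<and>
          (\<forall>y. \<forall>T\<in>set_pmf (D i). length (queries y T) \<le> l))"

text \<open>
  For every \<open>j\<close>, the \<open>j\<close>-th query is uniform over the coordinates.  For algorithms
  whose number of queries varies, this is meant conditionally on a \<open>j\<close>-th query being made.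
\<close>

definition perfectly_smooth :: "('i::finite, 's) corrector \<Rightarrow> bool" where
  "perfectly_smooth D \<longleftrightarrow>
     (\<forall>i y j x.
        measure_pmf.prob (D i) {T. j < length (queries y T) \<and> queries y T ! j = x} =
        measure_pmf.prob (D i) {T. j < length (queries y T)} / real CARD('i))"

section \<open>The local corrector of the lifted code\<close>

definition pt_infinity :: "('a::field, 2) proj" where
  "pt_infinity = abs_proj (axis 1 1)"

definition Emb_at ::
    "('a::field, 'n::{finite, linorder}) proj \<Rightarrow> ('a ^ 2 \<Rightarrow> ('a, 'n) vec) set" where
  "Emb_at P = {L \<in> Emb. L (axis 1 1) = std_rep P}"

definition proj_map ::
    "('a::field ^ 2 \<Rightarrow> 'a ^ 'n::finite) \<Rightarrow> ('a, 2) proj \<Rightarrow> ('a, 'n) proj" where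
  "proj_map L Q = abs_proj (L (std_rep Q))"

definition scale_factor ::
    "('a::field ^ 2 \<Rightarrow> 'a ^ 'n::{finite, linorder}) \<Rightarrow> ('a, 2) proj \<Rightarrow> 'a" where
  "scale_factor L Q = (THE c. c \<noteq> 0 \<and> c *s L (std_rep Q) = std_rep (proj_map L Q))"

definition eval_weight ::
    "nat \<Rightarrow> ('a::field ^ 2 \<Rightarrow> 'a ^ 'n::{finite, linorder}) \<Rightarrow> ('a, 2) proj \<Rightarrow> 'a" where
  "eval_weight v L Q = scale_factor L Q ^ v"

definition query_generator ::
    "nat \<Rightarrow>
     (('a::{field, finite}, 'n::{finite, linorder}) proj \<Rightarrow> ('a ^ 2 \<Rightarrow> ('a, 'n) vec) \<Rightarrow>
       ('a, 'n) proj set pmf) \<Rightarrow> bool" where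
  "query_generator s R \<longleftrightarrow>
     (\<forall>P. (\<forall>L\<in>Emb_at P. \<forall>S\<in>set_pmf (R P L). S \<subseteq> range (proj_map L) \<and> card S = s) \<and>
          (\<forall>X. measure_pmf.prob (bind_pmf (pmf_of_set (Emb_at P)) (R P)) {S. X \<in> S} =
               real s / real CARD(('a, 'n) proj)))"

text \<open>\<open>None\<close> is an erasure in the input word, and failure of the algorithm in the output.\<close>

definition corrects_errors_erasures ::
    "('i::finite \<Rightarrow> 's) set \<Rightarrow> nat \<Rightarrow> nat \<Rightarrow> (('i \<Rightarrow> 's option) \<Rightarrow> ('i \<Rightarrow> 's) option) \<Rightarrow> bool"
  where
  "corrects_errors_erasures C e t corr \<longleftrightarrow>
     (\<forall>c\<in>C. \<forall>y. card {i. y i = None} = e \<and> card {i. y i \<noteq> None \<and> y i \<noteq> Some (c i)} \<le> t \<longrightarrow>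
        corr y = Some c)"

text \<open>
  The word \<open>y'\<close> formed from the points \<open>Rs\<close> and the symbols \<open>ys\<close> read there: since an
  embedding induces an injective map on points, \<open>proj_map L Q\<close> is the \<open>j\<close>-th entry of
  \<open>Rs\<close> exactly if \<open>Q\<close> is its unique preimage.
\<close>

definition local_word ::
    "nat \<Rightarrow> ('a::field ^ 2 \<Rightarrow> 'a ^ 'n::{finite, linorder}) \<Rightarrow> ('a, 'n) proj list \<Rightarrow> 'a list \<Rightarrow>
     ('a, 2) proj \<Rightarrow> 'a option" where
  "local_word v L Rs ys Q =
     map_option (\<lambda>a. inverse (eval_weight v L Q) * a) (map_of (zip Rs ys) (proj_map L Q))"

text \<open>
  The points of the generated set are read in a uniformly random order: for a fixed
  enumeration of the set (say, a lexicographic one) the first query would in general not be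
  uniformly distributed.
\<close>

definition corr_PLift ::
    "nat \<Rightarrow>
     ((('a::{field, finite}, 2) proj \<Rightarrow> 'a option) \<Rightarrow> (('a, 2) proj \<Rightarrow> 'a) option) \<Rightarrow>
     (('a, 'n::{finite, linorder}) proj \<Rightarrow> ('a ^ 2 \<Rightarrow> ('a, 'n) vec) \<Rightarrow> ('a, 'n) proj set pmf) \<Rightarrow>
     (('a, 'n) proj, 'a) corrector" where
  "corr_PLift k corr R P =
     do {
       L \<leftarrow> pmf_of_set (Emb_at P);
       S \<leftarrow> R P L;
       Rs \<leftarrow> pmf_of_set (permutations_of_set S);
       return_pmf (ask_all Rs (\<lambda>ys.
         Answer (map_option (\<lambda>w. w pt_infinity)
           (corr (local_word (lift_degree TYPE('a) TYPE('n) k) L Rs ys)))))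
     }"

end

theory Submission
  imports Defs
begin

text \<open>
  Pulled back along a random line through \<open>P\<close>, and up to the non-zero weights, a codeword of the
  lifted code is a codeword of the projective Reed-Solomon code whose symbol at infinity is the
  one at \<open>P\<close>.  The local decoder therefore succeeds whenever the query set meets at most \<open>t\<close>
  errors.  As every point is queried with probability \<open>s/n\<close>, the expected number of errors met is
  at most \<open>\<delta> s\<close>, and Markov's inequality bounds the failure probability by \<open>\<delta> s / (t + 1)\<close>.
  Smoothness holds because every position of a uniformly ordered query set is a uniform element
  of that set.
\<close>

section \<open>Evaluation of polynomials, and composition with linear maps\<close>

lemma mpoly_eval_superset:
  assumes "finite A" "Poly_Mapping.keys f \<subseteq> A"
  shows "mpoly_eval f x =
    (\<Sum>e\<in>A. Poly_Mapping.lookup f e * (\<Prod>i\<in>UNIV. (x $ i) ^ Poly_Mapping.lookup e i))"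
  unfolding mpoly_eval_def
  by (rule sum.mono_neutral_left) (use assms in \<open>auto simp: in_keys_iff\<close>)

lemma mpoly_eval_zero [simp]: "mpoly_eval 0 x = 0"
  by (simp add: mpoly_eval_def)

text \<open>Cancellation may remove monomials from the sum, so all three evaluations are taken over
  the union of the two supports.\<close>

lemma mpoly_eval_add: "mpoly_eval (f + g) x = mpoly_eval f x + mpoly_eval g x"
proof -
  let ?A = "Poly_Mapping.keys f \<union> Poly_Mapping.keys g"
  have "mpoly_eval h x =
      (\<Sum>e\<in>?A. Poly_Mapping.lookup h e * (\<Prod>i\<in>UNIV. (x $ i) ^ Poly_Mapping.lookup e i))"
    if "Poly_Mapping.keys h \<subseteq> ?A" for h
    using that by (intro mpoly_eval_superset) auto
  from this[of f] this[of g] this[of "f + g"] show ?thesis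
    using Poly_Mapping.keys_add[of f g]
    by (simp add: lookup_add ring_distribs sum.distrib)
qed

lemma mpoly_eval_sum: "mpoly_eval (sum h A) x = (\<Sum>a\<in>A. mpoly_eval (h a) x)"
  by (induction A rule: infinite_finite_induct) (simp_all add: mpoly_eval_add)

lemma mpoly_eval_single:
  "mpoly_eval (Poly_Mapping.single e a) x = a * (\<Prod>i\<in>UNIV. (x $ i) ^ Poly_Mapping.lookup e i)"
  by (subst mpoly_eval_superset[of "{e}"]) auto

lemma poly_mapping_as_sum_singles:
  "f = (\<Sum>e\<in>Poly_Mapping.keys f. Poly_Mapping.single e (Poly_Mapping.lookup f e))"
  by (rule poly_mapping_eqI) (auto simp: lookup_sum lookup_single when_def in_keys_iff)

text \<open>Expanding both factors into monomials reduces the claim to monomials, where exponents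
  add.\<close>

lemma mpoly_eval_mult: "mpoly_eval (f * g) x = mpoly_eval f x * mpoly_eval g x"
proof -
  let ?s = "\<lambda>f e. Poly_Mapping.single e (Poly_Mapping.lookup f e)"
  have "mpoly_eval (f * g) x =
      mpoly_eval ((\<Sum>e\<in>Poly_Mapping.keys f. ?s f e) * (\<Sum>e\<in>Poly_Mapping.keys g. ?s g e)) x"
    using poly_mapping_as_sum_singles by metis
  also have "\<dots> = mpoly_eval (\<Sum>e\<in>Poly_Mapping.keys f. ?s f e) x *
      mpoly_eval (\<Sum>e\<in>Poly_Mapping.keys g. ?s g e) x"
    by (simp add: sum_product mpoly_eval_sum mult_single mpoly_eval_single lookup_add power_add
        prod.distrib mult_ac)
  finally show ?thesis
    by (simp flip: poly_mapping_as_sum_singles)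
qed

lemma mpoly_eval_const: "mpoly_eval (Poly_Mapping.single 0 a) x = a"
  by (simp add: mpoly_eval_single)

lemma mpoly_eval_one [simp]: "mpoly_eval 1 x = 1"
  using mpoly_eval_const[of 1] by simp

lemma mpoly_eval_prod: "mpoly_eval (prod h A) x = (\<Prod>a\<in>A. mpoly_eval (h a) x)"
  by (induction A rule: infinite_finite_induct) (simp_all add: mpoly_eval_mult)

lemma mpoly_eval_power: "mpoly_eval (f ^ d) x = mpoly_eval f x ^ d"
  by (induction d) (simp_all add: mpoly_eval_mult)

lemma mpoly_eval_coord_form:
  fixes L :: "'a::field ^ 2 \<Rightarrow> 'a ^ 'n::finite"
  assumes "Vector_Spaces.linear (*s) (*s) L"
  shows "mpoly_eval (coord_form L i) x = L x $ i"
proof -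
  interpret L: Vector_Spaces.linear "(*s)" "(*s)" L by fact
  have "L x = L (\<Sum>j\<in>UNIV. (x $ j) *s axis j 1)"
    by (simp only: basis_expansion)
  also have "\<dots> = (\<Sum>j\<in>UNIV. (x $ j) *s L (axis j 1))"
    by (simp only: L.sum L.scale)
  finally have "L x $ i = (\<Sum>j\<in>UNIV. (x $ j) * L (axis j 1) $ i)"
    by simp
  moreover have "(\<Prod>i\<in>UNIV. (x $ i) ^ Poly_Mapping.lookup (Poly_Mapping.single j 1) i) = x $ j"
    for j
    by (subst prod.remove[of _ j]) (auto intro!: prod.neutral simp: lookup_single)
  ultimately show ?thesis
    by (simp add: coord_form_def mpoly_eval_sum mpoly_eval_single mult.commute)
qed

text \<open>Evaluation respects sums, products and powers, and each \<open>coord_form\<close>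
  evaluates to a coordinate of \<open>L x\<close>. From here on the substituted polynomial is
  handled only through its values.\<close>

lemma mpoly_eval_comp:
  assumes "Vector_Spaces.linear (*s) (*s) L"
  shows "mpoly_eval (mpoly_comp f L) x = mpoly_eval f (L x)"
  unfolding mpoly_comp_def mpoly_eval_sum mpoly_eval_mult mpoly_eval_prod mpoly_eval_power
    mpoly_eval_const mpoly_eval_coord_form[OF assms] mpoly_eval_def[of f] ..

lemma mpoly_eval_homogeneous:
  assumes "homogeneous d f"
  shows "mpoly_eval f (c *s x) = c ^ d * mpoly_eval f x"
proof -
  have "(\<Prod>i\<in>UNIV. (c * x $ i) ^ Poly_Mapping.lookup e i) =
      c ^ d * (\<Prod>i\<in>UNIV. (x $ i) ^ Poly_Mapping.lookup e i)"
    if "e \<in> Poly_Mapping.keys f" for e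
    using assms that
    by (auto simp: homogeneous_def power_mult_distrib prod.distrib simp flip: power_sum)
  then show ?thesis
    by (simp add: mpoly_eval_def sum_distrib_left mult_ac)
qed

section \<open>Standard representatives and the action of embeddings on points\<close>

lemma std_rep: "std_rep P \<noteq> 0" "abs_proj (std_rep P) = P" "leftmost_one (std_rep P)"
  using theI'[OF std_rep_ex1[of P]] unfolding std_rep_def by blast+

lemma std_rep_eqI:
  assumes "leftmost_one x" "abs_proj x = P"
  shows "std_rep P = x"
proof -
  have "x \<noteq> 0" using assms(1) by (auto simp: leftmost_one_def)
  then show ?thesis
    using assms std_rep std_rep_ex1[of P] by blast
qed

lemma abs_proj_eq_iff:
  fixes x y :: "'a::field ^ 'n::finite"
  assumes "x \<noteq> 0" "y \<noteq> 0"
  shows "abs_proj x = abs_proj y \<longleftrightarrow> (\<exists>c. c \<noteq> 0 \<and> y = c *s x)"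
proof -
  \<comment> \<open>\<open>proj_rel\<close> is reflexive only away from zero; this supplies the
    reflexivity conditions in \<open>Quotient_rel\<close>.\<close>
  have "proj_rel z z" if "z \<noteq> 0" for z :: "('a, 'n) vec"
    unfolding proj_rel_def using that by (intro conjI exI[of _ 1]) auto
  then have "abs_proj x = abs_proj y \<longleftrightarrow> proj_rel x y"
    using assms Quotient_rel[OF Quotient_proj] by blast
  then show ?thesis using assms by (simp add: proj_rel_def)
qed

lemma Emb_nonzero: "L \<in> Emb \<Longrightarrow> x \<noteq> 0 \<Longrightarrow> L x \<noteq> 0"
proof -
  assume L: "L \<in> Emb" and x: "x \<noteq> 0"
  then interpret Vector_Spaces.linear "(*s)" "(*s)" L by (simp add: Emb_def)
  show "L x \<noteq> 0" using L x zero by (metis (no_types, lifting) Emb_def injD mem_Collect_eq)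
qed

text \<open>If two images are proportional, linearity moves the scalar inside \<open>L\<close>, and
  injectivity of \<open>L\<close> makes the arguments proportional.\<close>

lemma inj_proj_map:
  assumes "L \<in> Emb"
  shows "inj (proj_map L)"
proof (rule injI)
  interpret Vector_Spaces.linear "(*s)" "(*s)" L using assms by (simp add: Emb_def)
  fix Q Q' assume "proj_map L Q = proj_map L Q'"
  then obtain c where c: "c \<noteq> 0" "L (std_rep Q') = c *s L (std_rep Q)"
    using abs_proj_eq_iff[OF Emb_nonzero[OF assms std_rep(1)] Emb_nonzero[OF assms std_rep(1)]]
    by (auto simp: proj_map_def)
  then have "L (std_rep Q') = L (c *s std_rep Q)"
    by (simp add: scale)
  then have "std_rep Q' = c *s std_rep Q"
    using assms by (auto simp: Emb_def inj_eq)
  then show "Q = Q'"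
    using c abs_proj_eq_iff[of "std_rep Q" "std_rep Q'"] std_rep by metis
qed

text \<open>Both vectors represent the same point, so a non-zero scalar relates them; it is unique
  because \<open>L (std_rep Q)\<close> is non-zero.\<close>

lemma scale_factor:
  assumes "L \<in> Emb"
  shows "scale_factor L Q \<noteq> 0"
    and "scale_factor L Q *s L (std_rep Q) = std_rep (proj_map L Q)"
proof -
  have nz: "L (std_rep Q) \<noteq> 0" using assms std_rep(1) by (rule Emb_nonzero)
  have "abs_proj (L (std_rep Q)) = abs_proj (std_rep (proj_map L Q))"
    by (simp add: proj_map_def std_rep)
  then obtain c where c: "c \<noteq> 0" "c *s L (std_rep Q) = std_rep (proj_map L Q)"
    using abs_proj_eq_iff[OF nz std_rep(1)] by metis
  have "d = c" if "d *s L (std_rep Q) = std_rep (proj_map L Q)" for d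
    using c nz that by (metis vec.scale_right_imp_eq)
  with c have "\<exists>!c. c \<noteq> 0 \<and> c *s L (std_rep Q) = std_rep (proj_map L Q)" by blast
  from theI'[OF this]
  show "scale_factor L Q \<noteq> 0" "scale_factor L Q *s L (std_rep Q) = std_rep (proj_map L Q)"
    unfolding scale_factor_def by blast+
qed

text \<open>By homogeneity, passing from \<open>L (std_rep Q)\<close> to the standard representative
  costs the \<open>v\<close>-th power of the scale factor. This is why \<open>local_word\<close>
  divides by the weight.\<close>

lemma ev_proj_map:
  assumes "homogeneous v f" "L \<in> Emb"
  shows "ev f (proj_map L Q) = eval_weight v L Q * ev (mpoly_comp f L) Q"
  using assms scale_factor(2)[OF assms(2), of Q]
  by (simp add: ev_def mpoly_eval_comp Emb_def eval_weight_def
      flip: mpoly_eval_homogeneous)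

lemma eval_weight_nonzero: "L \<in> Emb \<Longrightarrow> eval_weight v L Q \<noteq> 0"
  by (simp add: eval_weight_def scale_factor)

section \<open>The projective line, and lines through a given point\<close>

lemma type_2_cases: "j = (0::2) \<or> j = 1"
  using exhaust_2[of j] by auto

text \<open>The indices are residues modulo 2, ordered through their integer representatives. This
  fixes which coordinate of the plane is the left one for \<open>leftmost_one\<close>.\<close>

lemma less_type_2: "(0::2) < 1" "j < (1::2) \<Longrightarrow> j = 0" "\<not> j < (0::2)"
proof -
  show *: "(0::2) < 1" by (simp add: less_bit0_def bit0.Rep_0 bit0.Rep_1)
  show "j < (1::2) \<Longrightarrow> j = 0" "\<not> j < (0::2)" using type_2_cases[of j] * by auto
qed

lemma leftmost_one_2: "leftmost_one (x :: 'a::field ^ 2) \<longleftrightarrow> x $ 0 = 1 \<or> x $ 0 = 0 \<and> x $ 1 = 1"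
proof -
  have ex2: "(\<exists>i::2. Q i) \<longleftrightarrow> Q 0 \<or> Q 1" for Q
    by (metis type_2_cases)
  have "(\<forall>j<(0::2). x $ j = 0)" "(\<forall>j<(1::2). x $ j = 0) \<longleftrightarrow> x $ 0 = 0"
    using less_type_2 by auto
  then show ?thesis
    by (auto simp: leftmost_one_def ex2)
qed

lemma std_rep_pt_infinity: "std_rep (pt_infinity :: ('a::field, 2) proj) = axis 1 1"
  by (rule std_rep_eqI) (simp_all add: pt_infinity_def leftmost_one_2 axis_def)

text \<open>Points are counted by their standard representatives, which are \<open>(0, 1)\<close>
  and the vectors \<open>(1, y)\<close>.\<close>

lemma card_proj_line: "CARD(('a::{field, finite}, 2) proj) = CARD('a) + 1"
proof -
  let ?v = "\<lambda>x y :: 'a. \<chi> i::2. if i = 0 then x else y"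
  have v: "?v a b $ 0 = a" "?v a b $ 1 = b" for a b by simp_all
  have v_eqI: "x = ?v a b" if "x $ 0 = a" "x $ 1 = b" for x a b
  proof -
    have "x $ j = ?v a b $ j" for j
      using type_2_cases[of j] that by auto
    then show ?thesis by (simp add: vec_eq_iff)
  qed
  have bij: "bij_betw std_rep (UNIV :: ('a, 2) proj set) {x. leftmost_one x}"
    by (rule bij_betwI[where g = abs_proj]) (auto simp: std_rep intro: std_rep_eqI)
  have lead: "{x. leftmost_one x} = insert (?v 0 1) (range (?v 1))"
  proof (intro equalityI subsetI)
    fix x :: "'a ^ 2" assume "x \<in> {x. leftmost_one x}"
    then consider "x $ 0 = 1" | "x $ 0 = 0" "x $ 1 = 1" by (auto simp: leftmost_one_2)
    then show "x \<in> insert (?v 0 1) (range (?v 1))"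
      by cases (blast intro: v_eqI)+
  qed (auto simp: leftmost_one_2)
  have "inj (?v 1)"
    by (rule injI) (metis v(2))
  then have "card (range (?v 1)) = CARD('a)"
    by (rule card_image)
  moreover have "?v 0 1 \<notin> range (?v 1)"
  proof
    assume "?v 0 1 \<in> range (?v 1)"
    then obtain y where "?v 0 1 = ?v 1 y" by (rule rangeE)
    then have "?v 0 1 $ 0 = ?v 1 y $ 0" by (rule arg_cong)
    then show False by simp
  qed
  ultimately have "card {x :: 'a ^ 2. leftmost_one x} = CARD('a) + 1"
    unfolding lead by (subst card_insert_disjoint) simp_all
  then show ?thesis
    using bij_betw_same_card[OF bij] by simp
qed

text \<open>Makes the uniform choice of a line through \<open>P\<close> meaningful, since
  \<open>pmf_of_set\<close> is specified only on non-empty finite sets.\<close>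

lemma Emb_at_nonempty:
  assumes "CARD('n::{finite, linorder}) \<ge> 2"
  shows "Emb_at (P :: ('a::field, 'n) proj) \<noteq> {}"
proof -
  let ?x = "std_rep P"
  obtain i where i: "?x $ i = 1" using std_rep(3)[of P] by (auto simp: leftmost_one_def)
  obtain j where j: "j \<noteq> i"
    using assms by (metis (full_types) UNIV_I card_1_singleton_iff ex_card finite
      is_singletonI' is_singleton_altdef numeral_le_one_iff semiring_norm(69) UNIV_not_empty)
  \<comment> \<open>The vector \<open>(0, 1)\<close> goes to the representative of \<open>P\<close>
    and \<open>(1, 0)\<close> to the unit vector at \<open>j\<close>. Coordinate \<open>i\<close> of
    \<open>L a\<close> is \<open>a $ 1\<close>; once that vanishes, coordinate \<open>j\<close> is
    \<open>a $ 0\<close>, so the kernel is trivial.\<close>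
  define L where "L = (\<lambda>a :: 'a ^ 2. (a $ 1) *s ?x + (a $ 0) *s axis j 1)"
  have lin: "Vector_Spaces.linear (*s) (*s) L"
    by unfold_locales (simp_all add: L_def vec_eq_iff algebra_simps)
  interpret Vector_Spaces.linear "(*s)" "(*s)" L by fact
  have "a = 0" if "L a = 0" for a
  proof -
    have "L a $ i = 0" "L a $ j = 0" using that by simp_all
    then have "a $ 1 = 0" "a $ 0 = 0" using i j by (auto simp: L_def axis_def)
    then have "a $ l = 0" for l using type_2_cases[of l] by auto
    then show "a = 0" by (simp add: vec_eq_iff)
  qed
  then have "inj L" by (simp add: inj_iff_eq_0)
  moreover have "L (axis 1 1) = ?x" by (simp add: L_def axis_def vec_eq_iff)
  ultimately show ?thesis using lin by (auto simp: Emb_at_def Emb_def)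
qed


section \<open>Query trees and randomly ordered query sets\<close>

lemma run_ask_all: "run y (ask_all Rs K) = run y (K (map y Rs))"
  by (induction Rs arbitrary: K) simp_all

lemma queries_ask_all: "queries y (ask_all Rs K) = Rs @ queries y (K (map y Rs))"
  by (induction Rs arbitrary: K) simp_all

lemma map_pmf_set_permutations:
  "finite S \<Longrightarrow> map_pmf set (pmf_of_set (permutations_of_set S)) = return_pmf S"
  by (subst map_pmf_eq_return_pmf_iff) (auto dest: permutations_of_setD)

text \<open>
  Transpositions of \<open>S\<close> preserve the uniform distribution on its enumerations, hence all
  elements of \<open>S\<close> are equally likely to be in position \<open>j\<close>.
\<close>

lemma map_pmf_nth_permutations:
  assumes "finite S" "j < card S"
  shows "map_pmf (\<lambda>xs. xs ! j) (pmf_of_set (permutations_of_set S)) = pmf_of_set S"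
proof -
  let ?U = "pmf_of_set (permutations_of_set S)"
  let ?M = "map_pmf (\<lambda>xs. xs ! j) ?U"
  have ne: "permutations_of_set S \<noteq> {}" and S: "S \<noteq> {}" using assms by auto
  have set_M: "set_pmf ?M \<subseteq> S"
  proof -
    have "xs ! j \<in> S" if "xs \<in> permutations_of_set S" for xs
      using that assms(2) length_finite_permutations_of_set[OF that]
      by (metis nth_mem permutations_of_setD(1))
    then show ?thesis using ne by auto
  qed
  have symm: "pmf ?M x = pmf ?M y" if "x \<in> S" "y \<in> S" for x y
  proof -
    let ?\<pi> = "Transposition.transpose x y"
    have inj: "inj ?\<pi>" by simp
    have "map ?\<pi> ` permutations_of_set S = permutations_of_set S"
      using permutations_of_set_image_inj[of ?\<pi> S] that
      by (simp add: inj_on_subset[OF inj] transpose_image_eq)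
    then have U: "map_pmf (map ?\<pi>) ?U = ?U"
      using ne by (subst map_pmf_of_set_inj) (auto intro: inj_on_subset[OF inj_mapI[OF inj]])
    \<comment> \<open>Relabelling by the transposition commutes with reading position
      \<open>j\<close>, which lies within every enumeration of \<open>S\<close>.\<close>
    have "map_pmf ?\<pi> ?M = map_pmf (\<lambda>xs. xs ! j) (map_pmf (map ?\<pi>) ?U)"
      unfolding map_pmf_comp using assms ne
      by (intro map_pmf_cong)
        (auto simp: length_finite_permutations_of_set)
    then have "map_pmf ?\<pi> ?M = ?M" by (simp add: U)
    then show ?thesis
      using pmf_map_inj'[OF inj, of ?M x] by simp
  qed
  show ?thesis
  proof (rule pmf_eqI)
    fix x
    have "pmf ?M x * card S = 1" if "x \<in> S"
    proof -
      have "(\<Sum>y\<in>S. pmf ?M y) = 1"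
        using sum_pmf_eq_1[OF assms(1) set_M] .
      moreover have "(\<Sum>y\<in>S. pmf ?M y) = (\<Sum>y\<in>S. pmf ?M x)"
        using that by (intro sum.cong symm) auto
      ultimately show ?thesis by (simp add: mult.commute)
    qed
    moreover have "pmf ?M x = 0" if "x \<notin> S"
      using that set_M by (meson set_pmf_iff subsetD)
    ultimately show "pmf ?M x = pmf (pmf_of_set S) x"
      using assms S by (auto simp: indicator_def field_simps)
  qed
qed

text \<open>The size of the intersection is a sum of indicators over \<open>E\<close>, so its
  expectation is \<open>card E * p\<close> without any independence; Markov's inequality then
  applies.\<close>

lemma expected_intersection_markov:
  fixes Q :: "'x::finite set pmf"
  assumes "\<And>X. measure_pmf.prob Q {S. X \<in> S} = p"
  shows "measure_pmf.prob Q {S. t < card (S \<inter> E)} \<le> real (card E) * p / real (t + 1)"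
proof -
  have int: "integrable Q f" for f :: "'x set \<Rightarrow> real"
    by (rule integrable_measure_pmf_finite) simp
  \<comment> \<open>Cardinalities are integers, so exceeding \<open>t\<close> means reaching
    \<open>t + 1\<close>; this yields the denominator \<open>t + 1\<close>.\<close>
  have "measure_pmf.prob Q {S. t < card (S \<inter> E)} =
      measure_pmf.prob Q {S \<in> space Q. real (card (S \<inter> E)) \<ge> real (t + 1)}"
    by (rule arg_cong[where f = "measure_pmf.prob Q"]) auto
  also have "\<dots> \<le> (\<integral>S. real (card (S \<inter> E)) \<partial>Q) / real (t + 1)"
    by (rule integral_Markov_inequality_measure[where A = "{}"]) (auto intro: int)
  also have "(\<integral>S. real (card (S \<inter> E)) \<partial>Q) = (\<integral>S. (\<Sum>X\<in>E. indicator {S. X \<in> S} S) \<partial>Q)"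
    by (rule Bochner_Integration.integral_cong)
      (auto simp: indicator_def sum.If_cases Int_def conj_commute intro!: arg_cong[where f = card])
  also have "\<dots> = (\<Sum>X\<in>E. measure_pmf.prob Q {S. X \<in> S})"
    by (subst Bochner_Integration.integral_sum) (auto intro: int)
  also have "\<dots> = real (card E) * p" by (simp add: assms)
  finally show ?thesis .
qed

section \<open>Decoding along one line\<close>

text \<open>Since points of the line correspond injectively to points of the projective line, the
  erasures are the \<open>q + 1 - s\<close> unqueried points, and after division by the weights the
  wrong symbols are exactly the errors of \<open>y\<close> in the query set. Both counts are within
  the capacity of \<open>corr\<close>.\<close>

lemma corr_local_word:
  fixes P :: "('a::{field, finite}, 'n::{finite, linorder}) proj"
  assumes f: "homogeneous v f" "\<And>L. L \<in> Emb \<Longrightarrow> ev (mpoly_comp f L) \<in> C"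
    and corr: "corrects_errors_erasures C (CARD('a) + 1 - s) t corr"
    and L: "L \<in> Emb_at P"
    and Rs: "set Rs \<subseteq> range (proj_map L)" "card (set Rs) = s"
    and err: "card (set Rs \<inter> {X. y X \<noteq> ev f X}) \<le> t"
  shows "map_option (\<lambda>w. w pt_infinity) (corr (local_word v L Rs (map y Rs))) = Some (ev f P)"
proof -
  let ?w = "local_word v L Rs (map y Rs)" and ?c = "ev (mpoly_comp f L)"
  let ?K = "{Q. proj_map L Q \<in> set Rs}"
  have LE: "L \<in> Emb" and LP: "L (axis 1 1) = std_rep P" using L by (auto simp: Emb_at_def)
  have w: "?w Q = (if Q \<in> ?K then Some (inverse (eval_weight v L Q) * y (proj_map L Q)) else None)"
    for Q
    by (simp add: local_word_def map_of_zip_map)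
  have card_preimage: "card {Q. proj_map L Q \<in> A} = card A" if "A \<subseteq> range (proj_map L)" for A
    using that card_vimage_inj[OF inj_proj_map[OF LE]] by (simp add: vimage_def)
  have "{Q. ?w Q = None} = UNIV - ?K" by (auto simp: w)
  then have "card {Q. ?w Q = None} = CARD('a) + 1 - s"
    using Rs by (simp add: card_Diff_subset card_preimage card_proj_line)
  moreover have "card {Q. ?w Q \<noteq> None \<and> ?w Q \<noteq> Some (?c Q)} \<le> t"
  proof -
    have "inverse (eval_weight v L Q) * a = ?c Q \<longleftrightarrow> a = ev f (proj_map L Q)" for Q a
      unfolding ev_proj_map[OF f(1) LE] using eval_weight_nonzero[OF LE, of v Q]
      by (simp add: field_simps)
    then have "{Q. ?w Q \<noteq> None \<and> ?w Q \<noteq> Some (?c Q)} =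
        {Q. proj_map L Q \<in> set Rs \<inter> {X. y X \<noteq> ev f X}}"
      by (auto simp: w)
    also have "card \<dots> = card (set Rs \<inter> {X. y X \<noteq> ev f X})"
      using Rs by (intro card_preimage) auto
    finally show ?thesis using err by simp
  qed
  ultimately have "corr ?w = Some ?c"
    using corr f(2)[OF LE] unfolding corrects_errors_erasures_def by blast
  \<comment> \<open>No weight appears here: \<open>L\<close> sends the standard representative of
    infinity to that of \<open>P\<close>.\<close>
  moreover have "?c pt_infinity = ev f P"
    using LE LP by (simp add: ev_def mpoly_eval_comp Emb_def std_rep_pt_infinity)
  ultimately show ?thesis by simp
qed

section \<open>Presenting the lifted code as the image of an encoder\<close>

text \<open>The encoder may be non-injective, so each letter can name a whole codeword and only the
  first letter of a word is used; \<open>K > 0\<close> guarantees that there is one.\<close>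

lemma is_code_of_nonempty:
  fixes C :: "('i::finite \<Rightarrow> 's::finite) set"
  assumes "C \<noteq> {}" "K > 0"
  shows "\<exists>\<Sigma>. is_code C \<Sigma> K"
proof -
  obtain g where g: "bij_betw g {0..<card C} C"
    using ex_bij_betw_nat_finite[of C] by auto
  let ?W = "{w. length w = K \<and> set w \<subseteq> {0..<card C}}"
  have "hd ` ?W = {0..<card C}"
  proof (intro equalityI subsetI)
    fix a assume "a \<in> {0..<card C}"
    then show "a \<in> hd ` ?W" using assms(2)
      by (intro image_eqI[of _ _ "replicate K a"]) (auto simp: hd_replicate)
  next
    fix a assume "a \<in> hd ` ?W"
    then obtain w where "a = hd w" "length w = K" "set w \<subseteq> {0..<card C}" by blast
    moreover from this have "hd w \<in> set w" using assms(2) by (intro hd_in_set) auto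
    ultimately show "a \<in> {0..<card C}" by blast
  qed
  then have "(g \<circ> hd) ` ?W = C"
    using g by (simp only: image_comp[symmetric] bij_betw_def)
  then show ?thesis unfolding is_code_def by blast
qed

lemma zero_in_PLift:
  "(\<lambda>_. 0) \<in> (PLift k :: (('a::{field, finite}, 'n::{finite, linorder}) proj \<Rightarrow> 'a) set)"
proof -
  have "(\<lambda>_. 0) = ev (0 :: ('n, 'a) mpoly)" "(\<lambda>_. 0) = ev (0 :: (2, 'a) mpoly)"
    by (simp_all add: ev_def fun_eq_iff)
  moreover have "mpoly_comp (0 :: ('n, 'a) mpoly) L = 0" for L
    by (simp add: mpoly_comp_def)
  moreover have "homogeneous d (0 :: ('n, 'a) mpoly)" "homogeneous d (0 :: (2, 'a) mpoly)" for d
    by (simp_all add: homogeneous_def)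
  ultimately show ?thesis
    unfolding PLift_def PRS_def by (intro CollectI exI[of _ 0] conjI ballI) auto
qed

section \<open>Smoothness and correctness of the local corrector\<close>

theorem theorem34:
  fixes q m k s t :: nat and \<delta> :: real
    and R :: "('a::{field, finite}, 'n::{finite, linorder}) proj \<Rightarrow> ('a ^ 2 \<Rightarrow> ('a, 'n) vec) \<Rightarrow>
              ('a, 'n) proj set pmf"
    and corr :: "(('a, 2) proj \<Rightarrow> 'a option) \<Rightarrow> (('a, 2) proj \<Rightarrow> 'a) option"
  assumes "q = CARD('a)"
    and "CARD('n) = m + 1" and "m \<ge> 1"
    and "1 \<le> k" and "k \<le> q - 1"
    and "k + 1 \<le> s" and "s \<le> q"
    and "t = (s - k - 1) div 2"
    and "0 \<le> \<delta>" and "\<delta> \<le> real (t + 1) / (2 * real s)"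
    and "query_generator s R"
    and "corrects_errors_erasures (PRS k) (q + 1 - s) t corr"
  shows "locally_correctable_by (PLift k :: (('a, 'n) proj \<Rightarrow> 'a) set)
           s \<delta> (\<delta> * real s / real (t + 1)) (corr_PLift k corr R) \<and>
         perfectly_smooth (corr_PLift k corr R)"
proof
  let ?v = "lift_degree TYPE('a) TYPE('n) k" and ?n = "CARD(('a, 'n) proj)"
  let ?C = "PLift k :: (('a, 'n) proj \<Rightarrow> 'a) set"
  \<comment> \<open>\<open>Q\<close> is the law of the unordered query set, \<open>J\<close> records
    the line and the ordered queries, and \<open>tr\<close> is the deterministic tree they
    determine. The query list does not depend on \<open>y\<close>.\<close>
  define Q where "Q P = bind_pmf (pmf_of_set (Emb_at P)) (R P)" for P
  define J where "J P = do {L \<leftarrow> pmf_of_set (Emb_at P); S \<leftarrow> R P L;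
      Rs \<leftarrow> pmf_of_set (permutations_of_set S); return_pmf (L, Rs)}" for P
  define tr :: "('a ^ 2 \<Rightarrow> ('a, 'n) vec) \<times> ('a, 'n) proj list \<Rightarrow> _" where
    "tr = (\<lambda>(L, Rs). ask_all Rs (\<lambda>ys. Answer (map_option (\<lambda>w. w pt_infinity)
      (corr (local_word ?v L Rs ys)))))"
  have D: "corr_PLift k corr R P = map_pmf tr (J P)" for P
    by (simp add: corr_PLift_def J_def tr_def map_bind_pmf)
  have queries_tr: "queries y (tr z) = snd z" for y z
    by (simp add: tr_def queries_ask_all split: prod.split)

  have ne: "Emb_at P \<noteq> {}" for P :: "('a, 'n) proj"
    by (rule Emb_at_nonempty) (use assms(2,3) in simp)
  have R: "S \<subseteq> range (proj_map L)" "card S = s" if "L \<in> Emb_at P" "S \<in> set_pmf (R P L)" for P L S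
    using assms(11) that by (auto simp: query_generator_def)
  have prob_Q: "measure_pmf.prob (Q P) {S. X \<in> S} = real s / real ?n" for P X
    using assms(11) by (simp add: query_generator_def Q_def)
  have set_Q: "card S = s" if "S \<in> set_pmf (Q P)" for P S
    using that R ne by (auto simp: Q_def)
  have set_J: "fst z \<in> Emb_at P" "set (snd z) \<subseteq> range (proj_map (fst z))"
      "card (set (snd z)) = s" "length (snd z) = s"
    if z_in: "z \<in> set_pmf (J P)" for z P
  proof -
    obtain L S Rs where z: "z = (L, Rs)" and LS: "L \<in> Emb_at P" "S \<in> set_pmf (R P L)"
      and Rs: "Rs \<in> permutations_of_set S"
      using z_in ne by (auto simp: J_def)
    show "fst z \<in> Emb_at P" "set (snd z) \<subseteq> range (proj_map (fst z))"
      "card (set (snd z)) = s" "length (snd z) = s"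
      using z LS permutations_of_setD[OF Rs] R[OF LS] distinct_card[of Rs] by auto
  qed
  have J_set: "map_pmf (\<lambda>z. set (snd z)) (J P) = Q P" for P
    using map_pmf_set_permutations[where ?'a = "('a, 'n) proj"]
    by (simp add: J_def Q_def map_bind_pmf map_pmf_comp bind_return_pmf' flip: map_pmf_def)
  \<comment> \<open>A fixed position of a random enumeration is a uniform element of the query set,
    so the line and the order can be forgotten.\<close>
  have J_nth: "map_pmf (\<lambda>z. snd z ! j) (J P) = bind_pmf (Q P) pmf_of_set" if "j < s" for j P
    using that ne R
    by (auto simp: J_def Q_def map_bind_pmf bind_assoc_pmf map_pmf_comp map_pmf_nth_permutations
        simp flip: map_pmf_def intro!: bind_pmf_cong)

  have s: "2 \<le> s" "t + 1 \<le> s" using assms by auto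
  \<comment> \<open>Any query set in the support of the generator consists of \<open>s\<close>
    distinct points.\<close>
  have "s \<le> ?n"
  proof -
    obtain S where "S \<in> set_pmf (Q undefined)" using set_pmf_not_empty by fast
    then show ?thesis using set_Q card_mono[of "UNIV :: ('a, 'n) proj set" S] by auto
  qed

  show "perfectly_smooth (corr_PLift k corr R)"
    unfolding perfectly_smooth_def
  proof (intro allI)
    fix P X :: "('a, 'n) proj" and y :: "('a, 'n) proj \<Rightarrow> 'a" and j
    let ?prob = "measure_pmf.prob (corr_PLift k corr R P)"
    \<comment> \<open>Every run makes exactly \<open>s\<close> queries, so the condition on
      \<open>j\<close> holds either always or never.\<close>
    have len: "?prob {T. j < length (queries y T) \<and> A (queries y T)} =
        (if j < s then measure_pmf.prob (J P) {z. A (snd z)} else 0)" for A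
    proof -
      have "?prob {T. j < length (queries y T) \<and> A (queries y T)} =
          measure_pmf.prob (J P) ({z. j < length (snd z) \<and> A (snd z)} \<inter> set_pmf (J P))"
        by (simp add: D vimage_def queries_tr measure_Int_set_pmf)
      also have "{z. j < length (snd z) \<and> A (snd z)} \<inter> set_pmf (J P) =
          (if j < s then {z. A (snd z)} \<inter> set_pmf (J P) else {})"
        using set_J(4) by auto
      finally show ?thesis by (simp add: measure_Int_set_pmf)
    qed
    have "measure_pmf.prob (J P) {z. snd z ! j = X} = 1 / real ?n" if "j < s"
    proof -
      have "measure_pmf.prob (J P) {z. snd z ! j = X} = pmf (bind_pmf (Q P) pmf_of_set) X"
        by (simp add: pmf_map vimage_def flip: J_nth[OF that])
      \<comment> \<open>Given the set, \<open>X\<close> is drawn with probability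
        \<open>1 / s\<close> if it belongs to it; belonging has probability \<open>s / n\<close>,
        which leaves \<open>1 / n\<close>.\<close>
      also have "\<dots> = (\<integral>S. indicator {S. X \<in> S} S / real s \<partial>Q P)"
        unfolding pmf_bind
      proof (intro integral_cong_AE AE_pmfI)
        fix S assume "S \<in> set_pmf (Q P)"
        then have "card S = s" by (rule set_Q)
        moreover from this have "S \<noteq> {}" using s by auto
        ultimately show "pmf (pmf_of_set S) X = indicator {S. X \<in> S} S / real s"
          by (simp add: indicator_def)
      qed auto
      also have "\<dots> = 1 / real ?n" using s by (simp add: prob_Q)
      finally show ?thesis .
    qed
    then show "?prob {T. j < length (queries y T) \<and> queries y T ! j = X} =
        ?prob {T. j < length (queries y T)} / real ?n"
      using len[of "\<lambda>Rs. Rs ! j = X"] len[of "\<lambda>_. True"] by simp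
  qed

  have correct: "measure_pmf.prob (corr_PLift k corr R P) {T. run y T = Some (c P)}
      \<ge> 1 - \<delta> * real s / real (t + 1)"
    if c: "c \<in> ?C" and dist: "real (hamming_dist y c) \<le> \<delta> * real ?n" for P c y
  proof -
    obtain f where f: "c = ev f" "homogeneous ?v f"
      "\<And>L :: 'a ^ 2 \<Rightarrow> ('a, 'n) vec. L \<in> Emb \<Longrightarrow> ev (mpoly_comp f L) \<in> PRS k"
      using c by (auto simp: PLift_def)
    let ?E = "{X. y X \<noteq> c X}"
    let ?bad = "{S. t < card (S \<inter> ?E)}"
    have "1 - \<delta> * real s / real (t + 1) \<le> 1 - real (card ?E) * (real s / real ?n) / real (t + 1)"
    proof -
      have "real (card ?E) * (real s / real ?n) \<le> \<delta> * real ?n * (real s / real ?n)"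
        using dist by (intro mult_right_mono) (auto simp: hamming_dist_def)
      also have "\<dots> = \<delta> * real s" by simp
      finally show ?thesis
        by (intro diff_left_mono divide_right_mono) simp_all
    qed
    also have "\<dots> \<le> 1 - measure_pmf.prob (Q P) ?bad"
      using expected_intersection_markov[OF prob_Q] by simp
    also have "\<dots> = measure_pmf.prob (Q P) (- ?bad)"
      using measure_pmf.prob_compl[of ?bad "Q P"] by (simp add: Compl_eq_Diff_UNIV)
    also have "\<dots> = measure_pmf.prob (J P) ((\<lambda>z. set (snd z)) -` (- ?bad))"
      by (simp flip: J_set)
    \<comment> \<open>On the support of \<open>J\<close>, a query set with at most \<open>t\<close>
      errors forces the right answer, so the good event is contained in success almost
      surely.\<close>
    also have "\<dots> \<le> measure_pmf.prob (J P) (tr -` {T. run y T = Some (c P)})"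
    proof (rule measure_pmf.finite_measure_mono_AE)
      have "run y (tr z) = Some (c P)"
        if "z \<in> set_pmf (J P)" "set (snd z) \<notin> ?bad" for z
        using corr_local_word[OF f(2,3) assms(12)[unfolded assms(1)] set_J(1-3)[OF that(1)], of y]
          that(2) f(1)
        by (auto simp: tr_def run_ask_all not_less split: prod.split)
      then show "AE z in J P. z \<in> (\<lambda>z. set (snd z)) -` (- ?bad) \<longrightarrow>
          z \<in> tr -` {T. run y T = Some (c P)}"
        by (auto intro!: AE_pmfI)
    qed simp
    finally show ?thesis by (simp add: D)
  qed

  \<comment> \<open>The bound on \<open>\<delta>\<close> even makes the failure probability at most
    one half.\<close>
  have \<epsilon>: "\<delta> * real s / real (t + 1) \<le> 1"
    using assms(10) s by (simp add: field_simps)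
  have "\<delta> \<le> 1"
  proof -
    have "real (t + 1) \<le> 2 * real s" using s by simp
    then have "real (t + 1) / (2 * real s) \<le> 1" using s by simp
    then show ?thesis using assms(10) by linarith
  qed
  \<comment> \<open>The message length is taken to be \<open>n\<close> itself, so that
    \<open>s \<le> K \<le> n\<close> reduces to \<open>s \<le> n\<close>.\<close>
  moreover obtain \<Sigma> where "is_code ?C \<Sigma> ?n"
    using is_code_of_nonempty[of ?C ?n] zero_in_PLift by auto
  moreover have "length (queries y T) \<le> s" if "T \<in> set_pmf (corr_PLift k corr R P)" for P y T
    using that set_J(4) by (auto simp: D queries_tr)
  ultimately show "locally_correctable_by ?C s \<delta> (\<delta> * real s / real (t + 1)) (corr_PLift k corr R)"
    unfolding locally_correctable_by_def
    using correct \<epsilon> \<open>s \<le> ?n\<close> s assms(9) by (auto intro!: exI[of _ \<Sigma>] exI[of _ ?n])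
qed

end
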